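(* Let $H>0$ with $H\neq\frac12$, and let $\{R^H(t),t\ge 0\}$ be the Riemann-Liouville process with index $H$. Then the dependence exponent $\kappa$ of $R^H$ is $\frac32-H$.
   Context: The Riemann-Liouville process with index $H$, where $H>0$ is a constant, is the centered Gaussian process $R^H(t)=\int_0^t (t-u)^{H-1/2}\,B(\mathrm{d}u)$, $0\le t<\infty$, where $B$ is a standard Brownian motion. The dependence exponent $\kappa$ of a Gaussian process $\{\zeta_t;t\ge 0\}$ is defined by $$\kappa=\inf_{0\le u<v<s<t}\ \sup\Big\{\gamma>0:\ \mathrm{Cov}(\zeta_v-\zeta_u,\ \zeta_{T+t}-\zeta_{T+s})=o(T^{-\gamma})\ \text{ as } T\to\infty\Big\}.$$
   Formalization: With γ>0 in the definition of κ, the claim fails for H>3/2 (no γ is admissible), so it is proved as stated for 0<H<3/2, H≠1/2; for all H>0, H≠1/2, it is proved with γ ranging over all real numbers. *)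

theory Defs
  imports "HOL-Probability.Probability" "HOL-Library.Landau_Symbols"
begin

text \<open>Processes indexed by \<open>[0,\<infinity>)\<close> are functions \<open>real \<Rightarrow> 'a \<Rightarrow> real\<close>; their values at
  negative times are irrelevant.\<close>

locale standard_brownian_motion = prob_space M
  for M :: "'a measure" and B :: "real \<Rightarrow> 'a \<Rightarrow> real" +
  assumes measurable_BM: "\<And>t. 0 \<le> t \<Longrightarrow> B t \<in> borel_measurable M"
    and BM_start: "AE \<omega> in M. B 0 \<omega> = 0"
    and BM_indep_increments:
      "\<And>(n::nat) p. 0 \<le> p 0 \<Longrightarrow> (\<And>i. i < n \<Longrightarrow> p i < p (Suc i)) \<Longrightarrow>
         indep_vars (\<lambda>_. borel) (\<lambda>i \<omega>. B (p (Suc i)) \<omega> - B (p i) \<omega>) {..<n}"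
    and BM_normal_increments:
      "\<And>s t. 0 \<le> s \<Longrightarrow> s < t \<Longrightarrow>
         distributed M lborel (\<lambda>\<omega>. B t \<omega> - B s \<omega>) (normal_density 0 (sqrt (t - s)))"
    and BM_continuous: "AE \<omega> in M. continuous_on {0..} (\<lambda>t. B t \<omega>)"

text \<open>Convergence in mean square. Extended nonnegative integrals are used so that a failure of
  integrability cannot be mistaken for convergence to zero.\<close>

definition L2_tendsto :: "'b measure \<Rightarrow> (nat \<Rightarrow> 'b \<Rightarrow> real) \<Rightarrow> ('b \<Rightarrow> real) \<Rightarrow> bool" where
  "L2_tendsto N X Y \<longleftrightarrow>
     (\<forall>n. X n \<in> borel_measurable N) \<and> Y \<in> borel_measurable N \<and>
     (\<lambda>n. \<integral>\<^sup>+ x. ennreal ((X n x - Y x)\<^sup>2) \<partial>N) \<longlonglongrightarrow> 0"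

definition partition_points :: "nat \<Rightarrow> (nat \<Rightarrow> real) \<Rightarrow> bool" where
  "partition_points n p \<longleftrightarrow> 0 \<le> p 0 \<and> (\<forall>i<n. p i < p (Suc i))"

definition step_fun :: "nat \<Rightarrow> (nat \<Rightarrow> real) \<Rightarrow> (nat \<Rightarrow> real) \<Rightarrow> real \<Rightarrow> real" where
  "step_fun n p c x = (\<Sum>i<n. c i * indicator {p i<..p (Suc i)} x)"

definition step_integral ::
  "(real \<Rightarrow> 'a \<Rightarrow> real) \<Rightarrow> nat \<Rightarrow> (nat \<Rightarrow> real) \<Rightarrow> (nat \<Rightarrow> real) \<Rightarrow> 'a \<Rightarrow> real" where
  "step_integral B n p c \<omega> = (\<Sum>i<n. c i * (B (p (Suc i)) \<omega> - B (p i) \<omega>))"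

text \<open>\<open>Z\<close> is a version of the Wiener integral \<open>\<integral> f(u) B(du)\<close> over \<open>[0,\<infinity>)\<close>, for a square integrable
  \<open>f\<close> vanishing on the negative half-line: the mean-square limit of the integrals of step
  functions converging to \<open>f\<close> in \<open>L\<^sup>2\<close>. By the Wiener isometry the limit does not depend, up to
  null sets, on the approximating sequence.\<close>

definition is_wiener_integral ::
  "'a measure \<Rightarrow> (real \<Rightarrow> 'a \<Rightarrow> real) \<Rightarrow> (real \<Rightarrow> real) \<Rightarrow> ('a \<Rightarrow> real) \<Rightarrow> bool" where
  "is_wiener_integral M B f Z \<longleftrightarrow>
     (\<exists>n p c. (\<forall>k. partition_points (n k) (p k)) \<and>
        L2_tendsto lborel (\<lambda>k. step_fun (n k) (p k) (c k)) f \<and>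
        L2_tendsto M (\<lambda>k. step_integral B (n k) (p k) (c k)) Z)"

definition riemann_liouville_process ::
  "'a measure \<Rightarrow> (real \<Rightarrow> 'a \<Rightarrow> real) \<Rightarrow> real \<Rightarrow> (real \<Rightarrow> 'a \<Rightarrow> real) \<Rightarrow> bool" where
  "riemann_liouville_process M B H R \<longleftrightarrow>
     (\<forall>t\<ge>0. is_wiener_integral M B
        (\<lambda>u. indicator {0..t} u * (t - u) powr (H - 1/2)) (R t))"

definition covariance :: "'a measure \<Rightarrow> ('a \<Rightarrow> real) \<Rightarrow> ('a \<Rightarrow> real) \<Rightarrow> real" where
  "covariance M X Y =
     (\<integral>\<omega>. (X \<omega> - (\<integral>x. X x \<partial>M)) * (Y \<omega> - (\<integral>x. Y x \<partial>M)) \<partial>M)"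

definition decay_rates ::
  "'a measure \<Rightarrow> (real \<Rightarrow> 'a \<Rightarrow> real) \<Rightarrow> real \<Rightarrow> real \<Rightarrow> real \<Rightarrow> real \<Rightarrow> real set" where
  "decay_rates M X u v s t =
     {\<gamma>. (\<lambda>T. covariance M (\<lambda>\<omega>. X v \<omega> - X u \<omega>) (\<lambda>\<omega>. X (T + t) \<omega> - X (T + s) \<omega>))
           \<in> o[at_top](\<lambda>T. T powr (-\<gamma>))}"

definition dependence_exponent :: "'a measure \<Rightarrow> (real \<Rightarrow> 'a \<Rightarrow> real) \<Rightarrow> ereal" where
  "dependence_exponent M X =
     (INF (u, v, s, t) \<in> {(u, v, s, t). 0 \<le> u \<and> u < v \<and> v < s \<and> s < t}.
        SUP \<gamma> \<in> {\<gamma>. \<gamma> > 0 \<and> \<gamma> \<in> decay_rates M X u v s t}. ereal \<gamma>)"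

text \<open>The same exponent without the restriction \<open>\<gamma> > 0\<close>. A set of decay rates is closed downwards,
  so the two suprema agree whenever some positive rate is admissible; they differ only for
  covariances having no positive rate of decay, where the supremum above is over the empty set.\<close>

definition signed_dependence_exponent :: "'a measure \<Rightarrow> (real \<Rightarrow> 'a \<Rightarrow> real) \<Rightarrow> ereal" where
  "signed_dependence_exponent M X =
     (INF (u, v, s, t) \<in> {(u, v, s, t). 0 \<le> u \<and> u < v \<and> v < s \<and> s < t}.
        SUP \<gamma> \<in> decay_rates M X u v s t. ereal \<gamma>)"

end

theory Submission
  imports Defs "HOL-Real_Asymp.Real_Asymp"
begin

text \<open>Put \<open>a = H - 1/2\<close>. By the Wiener isometry the covariance in question is
  \<open>\<integral> ((v - x)\<^sub>+\<^sup>a - (u - x)\<^sub>+\<^sup>a) ((T + t - x)\<^sup>a - (T + s - x)\<^sup>a) dx\<close>, taken over \<open>[0,v]\<close>.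
  There the second factor is asymptotic to \<open>a (t - s) T\<^sup>a\<^sup>-\<^sup>1\<close>, with a uniform bound of the same order
  from the mean value theorem, so by dominated convergence the covariance divided by
  \<open>T\<^sup>a\<^sup>-\<^sup>1\<close> converges to \<open>a (t - s) (v\<^sup>a\<^sup>+\<^sup>1 - u\<^sup>a\<^sup>+\<^sup>1) / (a + 1)\<close>. This limit is nonzero, so the admissible
  rates are exactly the \<open>\<gamma> < 1 - a = 3/2 - H\<close>, whatever \<open>u, v, s, t\<close> are.\<close>

section \<open>Square integrable functions\<close>

text \<open>Measurability is a separate clause because the square forgets the sign: \<open>f\<close>
  need not be measurable when its square is.\<close>

definition square_integrable :: "'b measure \<Rightarrow> ('b \<Rightarrow> real) \<Rightarrow> bool" where
  "square_integrable N f \<longleftrightarrow> f \<in> borel_measurable N \<and> integrable N (\<lambda>x. (f x)\<^sup>2)"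

lemma square_integrable_measurable [measurable_dest]:
  "square_integrable N f \<Longrightarrow> f \<in> borel_measurable N"
  by (simp add: square_integrable_def)

lemma square_integrable_power2:
  "square_integrable N f \<Longrightarrow> integrable N (\<lambda>x. (f x)\<^sup>2)"
  by (simp add: square_integrable_def)

lemma square_integrable_mult:
  assumes "square_integrable N f" "square_integrable N g"
  shows "integrable N (\<lambda>x. f x * g x)"
proof (rule Bochner_Integration.integrable_bound)
  show "integrable N (\<lambda>x. (f x)\<^sup>2 + (g x)\<^sup>2)"
    using assms by (intro Bochner_Integration.integrable_add square_integrable_power2)
  show "(\<lambda>x. f x * g x) \<in> borel_measurable N"
    using assms by (intro borel_measurable_times square_integrable_measurable)
  have "\<bar>p * q\<bar> \<le> p\<^sup>2 + q\<^sup>2" for p q :: real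
    using sum_squares_bound[of "\<bar>p\<bar>" "\<bar>q\<bar>"] abs_ge_zero[of "p * q"]
    unfolding abs_mult power2_abs by linarith
  then show "AE x in N. norm (f x * g x) \<le> norm ((f x)\<^sup>2 + (g x)\<^sup>2)"
    by auto
qed

lemma square_integrable_add:
  assumes "square_integrable N f" "square_integrable N g"
  shows "square_integrable N (\<lambda>x. f x + g x)"
  unfolding square_integrable_def
proof
  show "(\<lambda>x. f x + g x) \<in> borel_measurable N"
    using assms by (intro borel_measurable_add square_integrable_measurable)
  have "integrable N (\<lambda>x. (f x)\<^sup>2 + (g x)\<^sup>2 + 2 * (f x * g x))"
    using assms by (intro Bochner_Integration.integrable_add integrable_mult_right
        square_integrable_power2 square_integrable_mult)
  then show "integrable N (\<lambda>x. (f x + g x)\<^sup>2)"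
    by (simp add: power2_sum mult.assoc)
qed

lemma square_integrable_cmult:
  "square_integrable N f \<Longrightarrow> square_integrable N (\<lambda>x. c * f x)"
  by (auto simp: square_integrable_def power_mult_distrib)

lemma square_integrable_diff:
  assumes "square_integrable N f" "square_integrable N g"
  shows "square_integrable N (\<lambda>x. f x - g x)"
  using square_integrable_add[OF assms(1) square_integrable_cmult[OF assms(2), of "-1"]] by simp

lemma square_integrable_sum:
  assumes "\<And>i. i < n \<Longrightarrow> square_integrable N (F i)"
  shows "square_integrable N (\<lambda>x. \<Sum>i<(n::nat). c i * F i x)"
  using assms
proof (induction n)
  case 0
  then show ?case by (simp add: square_integrable_def)
next
  case (Suc n)
  then show ?case by (simp add: square_integrable_add square_integrable_cmult)
qed

lemma integral_sum_mult_sum: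
  assumes "\<And>i. i < n \<Longrightarrow> square_integrable N (F i)" "\<And>j. j < m \<Longrightarrow> square_integrable N (G j)"
  shows "(\<integral>x. (\<Sum>i<(n::nat). c i * F i x) * (\<Sum>j<(m::nat). d j * G j x) \<partial>N) =
    (\<Sum>i<n. \<Sum>j<m. c i * d j * (\<integral>x. F i x * G j x \<partial>N))"
proof -
  have int: "integrable N (\<lambda>x. c i * d j * (F i x * G j x))" if "i < n" "j < m" for i j
    using that assms by (intro integrable_mult_right square_integrable_mult) auto
  have "(\<integral>x. (\<Sum>i<n. c i * F i x) * (\<Sum>j<m. d j * G j x) \<partial>N) =
      (\<integral>x. (\<Sum>i<n. \<Sum>j<m. c i * d j * (F i x * G j x)) \<partial>N)"
    by (simp add: sum_product mult_ac)
  also have "\<dots> = (\<Sum>i<n. \<integral>x. (\<Sum>j<m. c i * d j * (F i x * G j x)) \<partial>N)"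
    by (intro Bochner_Integration.integral_sum Bochner_Integration.integrable_sum int) auto
  also have "\<dots> = (\<Sum>i<n. \<Sum>j<m. \<integral>x. c i * d j * (F i x * G j x) \<partial>N)"
    by (intro sum.cong refl Bochner_Integration.integral_sum int) auto
  finally show ?thesis by simp
qed

text \<open>Cauchy-Schwarz, from the nonnegativity of the integral of
  \<open>(f x - c * g x)\<^sup>2\<close> at the best \<open>c\<close>.\<close>

lemma integral_mult_power2_le:
  assumes f: "square_integrable N f" and g: "square_integrable N g"
  shows "(\<integral>x. f x * g x \<partial>N)\<^sup>2 \<le> (\<integral>x. (f x)\<^sup>2 \<partial>N) * (\<integral>x. (g x)\<^sup>2 \<partial>N)"
proof -
  define F G I where "F = (\<integral>x. (f x)\<^sup>2 \<partial>N)" and "G = (\<integral>x. (g x)\<^sup>2 \<partial>N)"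
    and "I = (\<integral>x. f x * g x \<partial>N)"
  have "G \<ge> 0" by (simp add: G_def)
  show ?thesis
  proof (cases "G = 0")
    case True
    then have "AE x in N. (g x)\<^sup>2 = 0"
      using integral_nonneg_eq_0_iff_AE[OF square_integrable_power2[OF g]] by (simp add: G_def)
    then have "AE x in N. f x * g x = 0"
      by eventually_elim simp
    then have "I = 0"
      unfolding I_def by (rule integral_eq_zero_AE)
    then show ?thesis by (simp add: I_def)
  next
    case False
    \<comment> \<open>This \<open>c\<close> minimizes the quadratic F - 2cI + c^2 G; the minimum F -
      I^2/G is nonnegative, which is the claim after multiplication by G > 0.\<close>
    define c where "c = I / G"
    have "0 \<le> (\<integral>x. (f x - c * g x)\<^sup>2 \<partial>N)" by simp
    also have "\<dots> = (\<integral>x. (f x)\<^sup>2 - (2 * c) * (f x * g x) + c\<^sup>2 * (g x)\<^sup>2 \<partial>N)"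
      by (intro Bochner_Integration.integral_cong refl)
        (simp add: power2_eq_square algebra_simps)
    also have "\<dots> = F - (2 * c) * I + c\<^sup>2 * G"
      using square_integrable_power2[OF f] square_integrable_power2[OF g]
        square_integrable_mult[OF f g]
      unfolding F_def G_def I_def
      by (subst Bochner_Integration.integral_add, simp, simp,
          subst Bochner_Integration.integral_diff) simp_all
    also have "\<dots> = F - I\<^sup>2 / G"
      using False by (simp add: c_def power2_eq_square)
    finally have "I\<^sup>2 \<le> F * G"
      using False \<open>G \<ge> 0\<close> by (simp add: field_simps)
    then show ?thesis by (simp only: F_def G_def I_def)
  qed
qed

text \<open>By Cauchy-Schwarz, a factor vanishing in mean square beats one whose norms converge.
  Letting \<open>Y\<close> vary with \<open>k\<close> covers both a fixed second factor and one that
  itself tends to zero.\<close>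

lemma tendsto_integral_mult_zero:
  assumes "eventually (\<lambda>k. square_integrable N (X k)) F"
    and "\<And>k. square_integrable N (Y k)"
    and "((\<lambda>k. \<integral>x. (X k x)\<^sup>2 \<partial>N) \<longlongrightarrow> 0) F"
    and "((\<lambda>k. \<integral>x. (Y k x)\<^sup>2 \<partial>N) \<longlongrightarrow> L) F"
  shows "((\<lambda>k. \<integral>x. X k x * Y k x \<partial>N) \<longlongrightarrow> 0) F"
proof -
  have "((\<lambda>k. (\<integral>x. X k x * Y k x \<partial>N)\<^sup>2) \<longlongrightarrow> 0) F"
  proof (rule tendsto_sandwich[of "\<lambda>_. 0"])
    show "((\<lambda>k. (\<integral>x. (X k x)\<^sup>2 \<partial>N) * (\<integral>x. (Y k x)\<^sup>2 \<partial>N)) \<longlongrightarrow> 0) F"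
      using tendsto_mult[OF assms(3,4)] by simp
    show "\<forall>\<^sub>F k in F. (\<integral>x. X k x * Y k x \<partial>N)\<^sup>2
        \<le> (\<integral>x. (X k x)\<^sup>2 \<partial>N) * (\<integral>x. (Y k x)\<^sup>2 \<partial>N)"
      using assms(1) by eventually_elim (intro integral_mult_power2_le assms(2))
  qed auto
  then have "((\<lambda>k. sqrt ((\<integral>x. X k x * Y k x \<partial>N)\<^sup>2)) \<longlongrightarrow> sqrt 0) F"
    by (rule tendsto_real_sqrt)
  then show ?thesis
    by (simp add: tendsto_rabs_zero_iff)
qed

text \<open>Extended integrals tending to 0 are eventually finite, so some \<open>X k - Y\<close> is
  square integrable, and then so is \<open>Y = X k - (X k - Y)\<close>. After that every extended
  integral agrees with the ordinary one.\<close>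

lemma L2_tendstoD:
  assumes "L2_tendsto N X Y" and X: "\<And>k. square_integrable N (X k)"
  shows "square_integrable N Y"
    and "(\<lambda>k. \<integral>x. (X k x - Y x)\<^sup>2 \<partial>N) \<longlonglongrightarrow> 0"
proof -
  have [measurable]: "Y \<in> borel_measurable N" "\<And>k. X k \<in> borel_measurable N"
    and lim: "(\<lambda>k. \<integral>\<^sup>+ x. ennreal ((X k x - Y x)\<^sup>2) \<partial>N) \<longlonglongrightarrow> 0"
    using assms(1) by (auto simp: L2_tendsto_def)
  \<comment> \<open>The bound 1 stands for any finite positive bound; one index below it
    suffices.\<close>
  have "eventually (\<lambda>k. (\<integral>\<^sup>+ x. ennreal ((X k x - Y x)\<^sup>2) \<partial>N) < 1) sequentially"
    using order_tendstoD(2)[OF lim, of 1] by simp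
  then obtain k where k: "(\<integral>\<^sup>+ x. ennreal ((X k x - Y x)\<^sup>2) \<partial>N) < 1"
    by (auto simp: eventually_sequentially)
  then have "integrable N (\<lambda>x. (X k x - Y x)\<^sup>2)"
    by (intro integrableI_nonneg) (auto intro: less_trans[OF k])
  then have "square_integrable N (\<lambda>x. X k x - Y x)"
    by (simp add: square_integrable_def)
  from square_integrable_diff[OF X[of k] this] show Y: "square_integrable N Y"
    by simp
  have "ennreal (\<integral>x. (X k x - Y x)\<^sup>2 \<partial>N) = (\<integral>\<^sup>+ x. ennreal ((X k x - Y x)\<^sup>2) \<partial>N)" for k
    using square_integrable_diff[OF X Y]
    by (intro nn_integral_eq_integral[symmetric] square_integrable_power2) auto
  with lim have "(\<lambda>k. ennreal (\<integral>x. (X k x - Y x)\<^sup>2 \<partial>N)) \<longlonglongrightarrow> ennreal 0"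
    by simp
  then show "(\<lambda>k. \<integral>x. (X k x - Y x)\<^sup>2 \<partial>N) \<longlonglongrightarrow> 0"
    by (subst (asm) tendsto_ennreal_iff) auto
qed

text \<open>Joint continuity of the inner product. The product XY is split as (X - X')(Y - Y') + (X
  - X')Y' + (Y - Y')X' + X'Y'; each of the first three terms contains a vanishing
  difference.\<close>

lemma L2_tendsto_integral_mult:
  assumes X: "\<And>k. square_integrable N (X k)" and Y: "\<And>k. square_integrable N (Y k)"
    and XX: "L2_tendsto N X X'" and YY: "L2_tendsto N Y Y'"
  shows "(\<lambda>k. \<integral>x. X k x * Y k x \<partial>N) \<longlonglongrightarrow> (\<integral>x. X' x * Y' x \<partial>N)"
proof -
  note X' = L2_tendstoD[OF XX X] and Y' = L2_tendstoD[OF YY Y]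
  have dX: "square_integrable N (\<lambda>x. X k x - X' x)" for k
    by (intro square_integrable_diff X X')
  have dY: "square_integrable N (\<lambda>x. Y k x - Y' x)" for k
    by (intro square_integrable_diff Y Y')
  have "(\<lambda>k. \<integral>x. (X k x - X' x) * (Y k x - Y' x) \<partial>N) \<longlonglongrightarrow> 0"
    "(\<lambda>k. \<integral>x. (X k x - X' x) * Y' x \<partial>N) \<longlonglongrightarrow> 0"
    "(\<lambda>k. \<integral>x. (Y k x - Y' x) * X' x \<partial>N) \<longlonglongrightarrow> 0"
    by (rule tendsto_integral_mult_zero X' Y' dX dY always_eventually allI tendsto_const)+
  from tendsto_add[OF tendsto_add[OF this(1,2)] tendsto_add[OF this(3)
        tendsto_const[of "\<integral>x. X' x * Y' x \<partial>N"]]]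
  have "(\<lambda>k. (\<integral>x. (X k x - X' x) * (Y k x - Y' x) \<partial>N) + (\<integral>x. (X k x - X' x) * Y' x \<partial>N) +
      ((\<integral>x. (Y k x - Y' x) * X' x \<partial>N) + (\<integral>x. X' x * Y' x \<partial>N)))
      \<longlonglongrightarrow> (\<integral>x. X' x * Y' x \<partial>N)"
    by simp
  also have "(\<lambda>k. (\<integral>x. (X k x - X' x) * (Y k x - Y' x) \<partial>N) + (\<integral>x. (X k x - X' x) * Y' x \<partial>N) +
      ((\<integral>x. (Y k x - Y' x) * X' x \<partial>N) + (\<integral>x. X' x * Y' x \<partial>N))) =
      (\<lambda>k. \<integral>x. X k x * Y k x \<partial>N)" (is "?l = ?r")
  proof
    fix k
    have "?r k = (\<integral>x. ((X k x - X' x) * (Y k x - Y' x) + (X k x - X' x) * Y' x) +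
        ((Y k x - Y' x) * X' x + X' x * Y' x) \<partial>N)"
      by (simp add: algebra_simps)
    also have "\<dots> = ?l k"
      by (simp only: Bochner_Integration.integral_add Bochner_Integration.integrable_add
          square_integrable_mult dX dY X' Y')
    finally show "?l k = ?r k" by simp
  qed
  finally show ?thesis .
qed

section \<open>The Wiener isometry\<close>

context standard_brownian_motion
begin

text \<open>The times are left unordered and the second moment is an absolute value because
  polarization applies this to cross differences such as B d - B a, whose time order is unknown. The
  case t < s follows from s < t by a change of sign.\<close>

lemma increment_moments:
  assumes "0 \<le> s" "0 \<le> t"
  shows increment_square_integrable: "square_integrable M (\<lambda>\<omega>. B t \<omega> - B s \<omega>)"
    and increment_expectation: "expectation (\<lambda>\<omega>. B t \<omega> - B s \<omega>) = 0"
    and increment_second_moment: "expectation (\<lambda>\<omega>. (B t \<omega> - B s \<omega>)\<^sup>2) = \<bar>t - s\<bar>"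
proof -
  have *: "square_integrable M (\<lambda>\<omega>. B t \<omega> - B s \<omega>) \<and> expectation (\<lambda>\<omega>. B t \<omega> - B s \<omega>) = 0 \<and>
      expectation (\<lambda>\<omega>. (B t \<omega> - B s \<omega>)\<^sup>2) = t - s" if "0 \<le> s" "s < t" for s t
  proof -
    note D = BM_normal_increments[OF that]
    have E: "expectation (\<lambda>\<omega>. B t \<omega> - B s \<omega>) = 0"
      by (rule normal_distributed_expectation[OF _ D]) (use that in simp)
    have V: "expectation (\<lambda>\<omega>. (B t \<omega> - B s \<omega>)\<^sup>2) = t - s"
      using normal_distributed_variance[OF _ D] that E by simp
    have "integrable M (\<lambda>\<omega>. (B t \<omega> - B s \<omega>)\<^sup>2)"
      using distributed_integrable[OF D, of "\<lambda>x. x\<^sup>2"]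
        integrable_normal_moment[of "sqrt (t - s)" 0 2] that by simp
    then show ?thesis
      using E V that measurable_BM by (auto simp: square_integrable_def)
  qed
  have "square_integrable M (\<lambda>\<omega>. B t \<omega> - B s \<omega>) \<and> expectation (\<lambda>\<omega>. B t \<omega> - B s \<omega>) = 0 \<and>
      expectation (\<lambda>\<omega>. (B t \<omega> - B s \<omega>)\<^sup>2) = \<bar>t - s\<bar>"
  proof (cases s t rule: linorder_cases)
    case less
    then show ?thesis using *[OF assms(1) less] by simp
  next
    case equal
    then show ?thesis by (simp add: square_integrable_def)
  next
    case greater
    note st = *[OF assms(2) greater]
    have "square_integrable M (\<lambda>\<omega>. B t \<omega> - B s \<omega>)"
      using square_integrable_cmult[of M "\<lambda>\<omega>. B s \<omega> - B t \<omega>" "-1"] st by simp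
    moreover have "expectation (\<lambda>\<omega>. B t \<omega> - B s \<omega>) = 0"
      using st Bochner_Integration.integral_minus[of M "\<lambda>\<omega>. B s \<omega> - B t \<omega>"] by simp
    ultimately show ?thesis
      using st greater by (simp add: power2_commute[of "B t _"])
  qed
  then show "square_integrable M (\<lambda>\<omega>. B t \<omega> - B s \<omega>)" "expectation (\<lambda>\<omega>. B t \<omega> - B s \<omega>) = 0"
    "expectation (\<lambda>\<omega>. (B t \<omega> - B s \<omega>)\<^sup>2) = \<bar>t - s\<bar>"
    by simp_all
qed

text \<open>Polarization of the second moments.\<close>

lemma increment_inner_product:
  assumes "0 \<le> a" "0 \<le> b" "0 \<le> c" "0 \<le> d"
  shows "expectation (\<lambda>\<omega>. (B b \<omega> - B a \<omega>) * (B d \<omega> - B c \<omega>)) =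
    (\<bar>d - a\<bar> + \<bar>c - b\<bar> - \<bar>d - b\<bar> - \<bar>c - a\<bar>) / 2"
proof -
  have "expectation (\<lambda>\<omega>. (B b \<omega> - B a \<omega>) * (B d \<omega> - B c \<omega>)) =
      expectation (\<lambda>\<omega>. (((B d \<omega> - B a \<omega>)\<^sup>2 + (B c \<omega> - B b \<omega>)\<^sup>2) -
        ((B d \<omega> - B b \<omega>)\<^sup>2 + (B c \<omega> - B a \<omega>)\<^sup>2)) / 2)"
    by (intro Bochner_Integration.integral_cong refl) (simp add: power2_eq_square field_simps)
  also have "\<dots> = ((\<bar>d - a\<bar> + \<bar>c - b\<bar>) - (\<bar>d - b\<bar> + \<bar>c - a\<bar>)) / 2"
    using assms
    by (simp add: Bochner_Integration.integral_add Bochner_Integration.integral_diff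
        Bochner_Integration.integrable_add Bochner_Integration.integrable_diff
        square_integrable_power2 increment_square_integrable increment_second_moment)
  finally show ?thesis by simp
qed

end

section \<open>Inner products of interval indicators, the Lebesgue side of the isometry\<close>

lemma square_integrable_indicator_Ioc:
  "square_integrable lborel (indicator {a<..b::real})"
proof -
  have "(\<lambda>x. (indicator {a<..b} x :: real)\<^sup>2) = indicator {a<..b}"
    by (auto simp: indicator_def)
  moreover have "{a<..b} \<subseteq> {a..b}"
    by auto
  then have "integrable lborel (indicat_real {a<..b})"
    by (intro integrable_real_indicator emeasure_bounded_finite
        bounded_subset[OF bounded_closed_interval]) auto
  ultimately show ?thesis
    by (simp add: square_integrable_def)
qed

text \<open>The length of the overlap of two intervals is put into the very form of
  \<open>increment_inner_product\<close>, so that increments and indicators can be compared without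
  cases on the position of the intervals.\<close>

lemma integral_indicator_Ioc_mult:
  fixes a b c d :: real
  assumes "a \<le> b" "c \<le> d"
  shows "(\<integral>x. indicator {a<..b} x * indicator {c<..d} x \<partial>lborel) =
    (\<bar>d - a\<bar> + \<bar>c - b\<bar> - \<bar>d - b\<bar> - \<bar>c - a\<bar>) / 2"
proof -
  have "(\<lambda>x. indicator {a<..b} x * indicator {c<..d} x :: real) =
      indicator {max a c<..min b d}"
    by (auto simp: indicator_def)
  then have "(\<integral>x. indicator {a<..b} x * indicator {c<..d} x \<partial>lborel) =
      measure lborel {max a c<..min b d}"
    by simp
  also have "\<dots> = (if max a c \<le> min b d then min b d - max a c else 0)"
    by auto
  also have "\<dots> = (\<bar>d - a\<bar> + \<bar>c - b\<bar> - \<bar>d - b\<bar> - \<bar>c - a\<bar>) / 2"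
    using assms by (auto simp: max_def min_def abs_if)
  finally show ?thesis .
qed

lemma partition_points_nonneg:
  assumes "partition_points n p" "i \<le> n"
  shows "0 \<le> p i"
  using assms(2)
proof (induction i)
  case 0
  then show ?case using assms(1) by (simp add: partition_points_def)
next
  case (Suc i)
  then have "p i < p (Suc i)" "0 \<le> p i" using assms(1) by (auto simp: partition_points_def)
  then show ?case by simp
qed

lemma square_integrable_step_fun: "square_integrable lborel (step_fun n p c)"
proof -
  have "step_fun n p c = (\<lambda>x. \<Sum>i<n. c i * indicator {p i<..p (Suc i)} x)"
    by (simp add: fun_eq_iff step_fun_def)
  then show ?thesis
    by (simp only: square_integrable_sum square_integrable_indicator_Ioc)
qed

section \<open>The isometry for step functions and its passage to the limit\<close>

context standard_brownian_motion
begin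

lemma square_integrable_step_integral:
  assumes "partition_points n p"
  shows "square_integrable M (step_integral B n p c)"
proof -
  have "step_integral B n p c = (\<lambda>\<omega>. \<Sum>i<n. c i * (B (p (Suc i)) \<omega> - B (p i) \<omega>))"
    by (simp add: fun_eq_iff step_integral_def)
  then show ?thesis
    using partition_points_nonneg[OF assms]
    by (auto intro!: square_integrable_sum increment_square_integrable)
qed

lemma expectation_step_integral:
  assumes "partition_points n p"
  shows "expectation (step_integral B n p c) = 0"
proof -
  \<comment> \<open>On a probability space the constant 1 is square integrable, so pairing with it
    turns square integrability into integrability.\<close>
  have "integrable M (\<lambda>\<omega>. B (p (Suc i)) \<omega> - B (p i) \<omega>)" if "i < n" for i
    using square_integrable_mult[OF increment_square_integrable, of "p i" "p (Suc i)" "\<lambda>_. 1"]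
      partition_points_nonneg[OF assms] that by (simp add: square_integrable_def)
  then show ?thesis
    using partition_points_nonneg[OF assms] unfolding step_integral_def
    by (subst Bochner_Integration.integral_sum) (auto simp: increment_expectation intro!: sum.neutral)
qed

text \<open>Bilinearity reduces the claim to one increment against another. Overlaps of arbitrary
  intervals are already computed, so the two partitions are used as they are, with no common
  refinement.\<close>

lemma step_isometry:
  assumes p: "partition_points n p" and q: "partition_points m q"
  shows "expectation (\<lambda>\<omega>. step_integral B n p c \<omega> * step_integral B m q d \<omega>) =
    (\<integral>x. step_fun n p c x * step_fun m q d x \<partial>lborel)"
proof -
  have "expectation (\<lambda>\<omega>. step_integral B n p c \<omega> * step_integral B m q d \<omega>) =
      (\<Sum>i<n. \<Sum>j<m. c i * d j * expectation (\<lambda>\<omega>. (B (p (Suc i)) \<omega> - B (p i) \<omega>) *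
        (B (q (Suc j)) \<omega> - B (q j) \<omega>)))"
    unfolding step_integral_def
    using partition_points_nonneg[OF p] partition_points_nonneg[OF q]
    by (intro integral_sum_mult_sum increment_square_integrable) auto
  also have "\<dots> = (\<Sum>i<n. \<Sum>j<m. c i * d j *
      (\<integral>x. indicator {p i<..p (Suc i)} x * indicator {q j<..q (Suc j)} x \<partial>lborel))"
  proof (intro sum.cong refl)
    fix i j assume "i \<in> {..<n}" "j \<in> {..<m}"
    then have "p i \<le> p (Suc i)" "q j \<le> q (Suc j)" "0 \<le> p i" "0 \<le> p (Suc i)"
      "0 \<le> q j" "0 \<le> q (Suc j)"
      using p q partition_points_nonneg[OF p] partition_points_nonneg[OF q]
      by (auto simp: partition_points_def less_imp_le)
    then show "c i * d j * expectation (\<lambda>\<omega>. (B (p (Suc i)) \<omega> - B (p i) \<omega>) *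
          (B (q (Suc j)) \<omega> - B (q j) \<omega>)) =
        c i * d j * (\<integral>x. indicator {p i<..p (Suc i)} x * indicator {q j<..q (Suc j)} x \<partial>lborel)"
      by (simp only: increment_inner_product integral_indicator_Ioc_mult)
  qed
  also have "\<dots> = (\<integral>x. step_fun n p c x * step_fun m q d x \<partial>lborel)"
    unfolding step_fun_def
    by (intro integral_sum_mult_sum[symmetric] square_integrable_indicator_Ioc)
  finally show ?thesis .
qed

lemma wiener_integral_square_integrable:
  assumes "is_wiener_integral M B f Z"
  shows "square_integrable lborel f" "square_integrable M Z"
  using assms L2_tendstoD(1) square_integrable_step_fun square_integrable_step_integral
  unfolding is_wiener_integral_def by blast+

lemma expectation_wiener_integral:
  assumes "is_wiener_integral M B f Z"
  shows "expectation Z = 0"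
proof -
  obtain n p c where npc: "\<And>k. partition_points (n k) (p k)"
    and Z: "L2_tendsto M (\<lambda>k. step_integral B (n k) (p k) (c k)) Z"
    using assms unfolding is_wiener_integral_def by blast
  \<comment> \<open>The mean is the inner product with the constant 1, so continuity of the inner
    product carries the zero means of the step integrals to \<open>Z\<close>.\<close>
  have one: "square_integrable M (\<lambda>_. 1)" "L2_tendsto M (\<lambda>_ _. 1) (\<lambda>_. 1)"
    by (auto simp: square_integrable_def L2_tendsto_def)
  have "(\<lambda>k. expectation (\<lambda>\<omega>. step_integral B (n k) (p k) (c k) \<omega> * 1)) \<longlonglongrightarrow>
      expectation (\<lambda>\<omega>. Z \<omega> * 1)"
    by (rule L2_tendsto_integral_mult[OF square_integrable_step_integral[OF npc] one(1) Z one(2)])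
  then have "(\<lambda>k. 0) \<longlonglongrightarrow> expectation Z"
    by (simp add: expectation_step_integral[OF npc])
  then show ?thesis
    using LIMSEQ_unique[OF tendsto_const] by metis
qed

text \<open>Each integral comes with its own approximating step functions. By
  \<open>step_isometry\<close> both sides are limits of the same sequence of numbers.\<close>

lemma wiener_isometry:
  assumes f: "is_wiener_integral M B f Y" and g: "is_wiener_integral M B g Z"
  shows "expectation (\<lambda>\<omega>. Y \<omega> * Z \<omega>) = (\<integral>x. f x * g x \<partial>lborel)"
proof -
  obtain n p c where p: "\<And>k. partition_points (n k) (p k)"
    and f: "L2_tendsto lborel (\<lambda>k. step_fun (n k) (p k) (c k)) f"
    and Y: "L2_tendsto M (\<lambda>k. step_integral B (n k) (p k) (c k)) Y"
    using f unfolding is_wiener_integral_def by blast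
  obtain m q d where q: "\<And>k. partition_points (m k) (q k)"
    and g: "L2_tendsto lborel (\<lambda>k. step_fun (m k) (q k) (d k)) g"
    and Z: "L2_tendsto M (\<lambda>k. step_integral B (m k) (q k) (d k)) Z"
    using g unfolding is_wiener_integral_def by blast
  have "(\<lambda>k. expectation (\<lambda>\<omega>. step_integral B (n k) (p k) (c k) \<omega> *
      step_integral B (m k) (q k) (d k) \<omega>)) \<longlonglongrightarrow> expectation (\<lambda>\<omega>. Y \<omega> * Z \<omega>)"
    by (rule L2_tendsto_integral_mult[OF square_integrable_step_integral[OF p]
          square_integrable_step_integral[OF q] Y Z])
  moreover have "(\<lambda>k. \<integral>x. step_fun (n k) (p k) (c k) x * step_fun (m k) (q k) (d k) x \<partial>lborel)
      \<longlonglongrightarrow> (\<integral>x. f x * g x \<partial>lborel)"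
    by (rule L2_tendsto_integral_mult[OF square_integrable_step_fun square_integrable_step_fun f g])
  ultimately show ?thesis
    unfolding step_isometry[OF p q] by (rule LIMSEQ_unique)
qed

end

section \<open>Asymptotics of the covariance\<close>

text \<open>The integrand of the process, with a = H - 1/2. For a < 0 the singularity at u = t gets
  the value 0, since \<open>0 powr a = 0\<close>.\<close>

definition rl_kernel :: "real \<Rightarrow> real \<Rightarrow> real \<Rightarrow> real" where
  "rl_kernel a t u = indicator {0..t} u * (t - u) powr a"

lemma rl_kernel_measurable [measurable]: "rl_kernel a t \<in> borel_measurable borel"
  unfolding rl_kernel_def by measurable

text \<open>The reflection x -> t - x moves the possible singularity to 0, where a > -1 makes the
  power integrable.\<close>

lemma has_bochner_integral_rl_kernel:
  assumes "a > -1" "0 \<le> t"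
  shows "has_bochner_integral lborel (rl_kernel a t) (t powr (a + 1) / (a + 1))"
proof -
  have "has_bochner_integral lborel (\<lambda>x. x powr a * indicator {0..t} x) (t powr (a + 1) / (a + 1))"
  proof (rule has_bochner_integral_nn_integral)
    show "(\<integral>\<^sup>+ x. ennreal (x powr a * indicator {0..t} x) \<partial>lborel) =
        ennreal (t powr (a + 1) / (a + 1))"
      using nn_integral_has_integral_lebesgue'[OF _ has_integral_powr_from_0[OF assms]]
      by (simp add: ennreal_mult' ennreal_indicator)
  qed (use assms in auto)
  then have "has_bochner_integral lborel
      (\<lambda>x. (t + -1 * x) powr a * indicator {0..t} (t + -1 * x)) (t powr (a + 1) / (a + 1))"
    by (subst (asm) lborel_has_bochner_integral_real_affine_iff[where c = "-1" and t = t]) simp_all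
  also have "(\<lambda>x. (t + -1 * x) powr a * indicator {0..t} (t + -1 * x)) = rl_kernel a t"
    by (auto simp: rl_kernel_def indicator_def)
  finally show ?thesis .
qed

text \<open>First-order expansion: (T + p)^a = T^a (1 + ap/T + O(1/T^2)), and the leading terms
  cancel.\<close>

lemma powr_shift_diff_asymp:
  fixes a p q :: real
  shows "((\<lambda>T. T powr (1 - a) * ((T + p) powr a - (T + q) powr a)) \<longlongrightarrow> a * (p - q)) at_top"
  by (real_asymp simp: algebra_simps)

text \<open>The mean value theorem gives the factor z^(a-1) with T < z < T + p, hence 1 < z/T \<le>
  1 + p. The bound is free of T and so serves as a majorant.\<close>

lemma powr_shift_diff_bound:
  fixes a p q T :: real
  assumes "0 < q" "q < p" "1 \<le> T"
  shows "\<bar>T powr (1 - a) * ((T + p) powr a - (T + q) powr a)\<bar> \<le>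
    \<bar>a\<bar> * (p - q) * (1 + p) powr \<bar>a - 1\<bar>"
proof -
  have "\<exists>z>T + q. z < T + p \<and> (T + p) powr a - (T + q) powr a =
      ((T + p) - (T + q)) * (a * z powr (a - 1))"
    by (rule MVT2) (use assms in \<open>auto intro!: derivative_eq_intros simp: powr_diff\<close>)
  then obtain z where z: "T + q < z" "z < T + p"
    and eq: "(T + p) powr a - (T + q) powr a = (p - q) * (a * z powr (a - 1))"
    by auto
  have "T powr (1 - a) * z powr (a - 1) = (z / T) powr (a - 1)"
    using z assms by (simp add: powr_divide powr_diff field_simps)
  \<comment> \<open>The sign of a - 1 is unknown; as z/T \<ge> 1, passing to the absolute value only
    enlarges the power and makes it increasing in the base.\<close>
  also have "\<dots> \<le> (z / T) powr \<bar>a - 1\<bar>"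
    using z assms by (intro powr_mono) auto
  also have "\<dots> \<le> (1 + p) powr \<bar>a - 1\<bar>"
  proof (rule powr_mono2)
    have "z \<le> T + p * 1" using z by simp
    also have "\<dots> \<le> T + p * T" using assms by (intro add_mono mult_left_mono) auto
    finally show "z / T \<le> 1 + p" using assms by (simp add: field_simps)
  qed (use z assms in auto)
  finally have "T powr (1 - a) * z powr (a - 1) \<le> (1 + p) powr \<bar>a - 1\<bar>" .
  then have "\<bar>a\<bar> * (p - q) * (T powr (1 - a) * z powr (a - 1)) \<le>
      \<bar>a\<bar> * (p - q) * (1 + p) powr \<bar>a - 1\<bar>"
    using assms by (intro mult_left_mono) auto
  moreover have "\<bar>T powr (1 - a) * ((T + p) powr a - (T + q) powr a)\<bar> =
      \<bar>a\<bar> * (p - q) * (T powr (1 - a) * z powr (a - 1))"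
    using assms by (simp add: eq abs_mult mult_ac)
  ultimately show ?thesis by simp
qed

lemma rl_kernel_covariance_limit:
  assumes a: "a > -1" and uvst: "0 \<le> u" "u < v" "v < s" "s < t"
  shows "((\<lambda>T. T powr (1 - a) * (\<integral>x. (rl_kernel a v x - rl_kernel a u x) *
      (rl_kernel a (T + t) x - rl_kernel a (T + s) x) \<partial>lborel)) \<longlongrightarrow>
    a * (t - s) * ((v powr (a + 1) - u powr (a + 1)) / (a + 1))) at_top"
proof -
  define g where "g x = rl_kernel a v x - rl_kernel a u x" for x
  define D where "D T x = T powr (1 - a) * (rl_kernel a (T + t) x - rl_kernel a (T + s) x)" for T x
  \<comment> \<open>The bound of \<open>powr_shift_diff_bound\<close> for the shifts t - x and s -
    x, made uniform in x by t - x \<le> t.\<close>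
  define C where "C = \<bar>a\<bar> * (t - s) * (1 + t) powr \<bar>a - 1\<bar>"
  have g: "has_bochner_integral lborel g ((v powr (a + 1) - u powr (a + 1)) / (a + 1))"
    unfolding g_def diff_divide_distrib using uvst
    by (intro has_bochner_integral_diff has_bochner_integral_rl_kernel a) auto
  then have gi: "integrable lborel g" and gv: "integral\<^sup>L lborel g = (v powr (a + 1) - u powr (a + 1)) / (a + 1)"
    by (auto simp: has_bochner_integral_iff)
  have [measurable]: "g \<in> borel_measurable borel" unfolding g_def by measurable
  have [measurable]: "D T \<in> borel_measurable borel" for T unfolding D_def by measurable
  \<comment> \<open>Only x in [0,v] matters for the integral. There x \<le> v < s < t, so both
    shifts are positive and both later kernels are plain powers.\<close>
  have g0: "g x = 0" if "x \<notin> {0..v}" for x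
    using that uvst by (auto simp: g_def rl_kernel_def indicator_def)
  have D: "D T x = T powr (1 - a) * ((T + (t - x)) powr a - (T + (s - x)) powr a)"
    if "x \<in> {0..v}" "T \<ge> 0" for T x
    using that uvst by (auto simp: D_def rl_kernel_def indicator_def algebra_simps)
  have bound: "\<bar>D T x\<bar> \<le> C" if "x \<in> {0..v}" "T \<ge> 1" for T x
  proof -
    have "\<bar>D T x\<bar> \<le> \<bar>a\<bar> * ((t - x) - (s - x)) * (1 + (t - x)) powr \<bar>a - 1\<bar>"
      unfolding D[OF that(1) order_trans[OF zero_le_one that(2)]]
      by (rule powr_shift_diff_bound) (use that uvst in auto)
    also have "\<dots> \<le> C"
      unfolding C_def using that uvst by (auto intro!: mult_left_mono powr_mono2)
    finally show ?thesis .
  qed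
  have "((\<lambda>T. \<integral>x. g x * D T x \<partial>lborel) \<longlongrightarrow> (\<integral>x. g x * (a * (t - s)) \<partial>lborel)) at_top"
  proof (rule integral_dominated_convergence_at_top)
    \<comment> \<open>For a < 0 the function \<open>g\<close> is unbounded near v, but it is
      integrable, and that is enough for the majorant.\<close>
    show "integrable lborel (\<lambda>x. C * \<bar>g x\<bar>)"
      using gi by (intro integrable_mult_right integrable_abs)
    show "\<forall>\<^sub>F T in at_top. AE x in lborel. norm (g x * D T x) \<le> C * \<bar>g x\<bar>"
      using eventually_ge_at_top[of 1]
    proof eventually_elim
      case (elim T)
      have "\<bar>g x\<bar> * \<bar>D T x\<bar> \<le> \<bar>g x\<bar> * C" for x
        using bound[OF _ elim, of x] g0[of x]
        by (cases "x \<in> {0..v}") (auto intro!: mult_left_mono)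
      then show ?case by (simp add: abs_mult mult.commute)
    qed
    show "AE x in lborel. ((\<lambda>T. g x * D T x) \<longlongrightarrow> g x * (a * (t - s))) at_top"
    proof (rule AE_I2)
      fix x
      show "((\<lambda>T. g x * D T x) \<longlongrightarrow> g x * (a * (t - s))) at_top"
      proof (cases "x \<in> {0..v}")
        case True
        have "\<forall>\<^sub>F T in at_top.
            T powr (1 - a) * ((T + (t - x)) powr a - (T + (s - x)) powr a) = D T x"
          using eventually_ge_at_top[of 0] by eventually_elim (simp only: D[OF True])
        then have "((\<lambda>T. D T x) \<longlongrightarrow> a * ((t - x) - (s - x))) at_top"
          by (rule Lim_transform_eventually[OF powr_shift_diff_asymp])
        then have "((\<lambda>T. D T x) \<longlongrightarrow> a * (t - s)) at_top"
          by simp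
        then show ?thesis by (intro tendsto_intros)
      next
        case False
        then show ?thesis using g0 by simp
      qed
    qed
  qed measurable
  moreover have "(\<integral>x. g x * (a * (t - s)) \<partial>lborel) =
      a * (t - s) * ((v powr (a + 1) - u powr (a + 1)) / (a + 1))"
    using gv by simp
  moreover have "(\<integral>x. g x * D T x \<partial>lborel) = T powr (1 - a) * (\<integral>x. (rl_kernel a v x -
      rl_kernel a u x) * (rl_kernel a (T + t) x - rl_kernel a (T + s) x) \<partial>lborel)" for T
    unfolding g_def D_def by (subst integral_mult_right_zero[symmetric]) (simp only: mult_ac)
  ultimately show ?thesis by simp
qed

section \<open>From the kernel integrals to the set of decay rates\<close>

lemma (in standard_brownian_motion) covariance_riemann_liouville:
  assumes R: "riemann_liouville_process M B H R"
    and "0 \<le> u" "0 \<le> v" "0 \<le> s" "0 \<le> t"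
  shows "covariance M (\<lambda>\<omega>. R v \<omega> - R u \<omega>) (\<lambda>\<omega>. R t \<omega> - R s \<omega>) =
    (\<integral>x. (rl_kernel (H - 1/2) v x - rl_kernel (H - 1/2) u x) *
      (rl_kernel (H - 1/2) t x - rl_kernel (H - 1/2) s x) \<partial>lborel)"
proof -
  let ?k = "rl_kernel (H - 1/2)"
  have W: "is_wiener_integral M B (?k r) (R r)" if "0 \<le> r" for r
    using R that unfolding riemann_liouville_process_def rl_kernel_def[abs_def] by blast
  note si = wiener_integral_square_integrable[OF W]
  have int: "integrable M (R r)" if "0 \<le> r" for r
    using square_integrable_mult[OF si(2)[OF that], of "\<lambda>_. 1"]
    by (simp add: square_integrable_def)
  have mean: "expectation (\<lambda>\<omega>. R r \<omega> - R r' \<omega>) = 0" if "0 \<le> r" "0 \<le> r'" for r r'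
    using that by (simp add: int expectation_wiener_integral[OF W])
  \<comment> \<open>The means vanish, so the covariance is the expected product; it is expanded into
    four products, each is moved to Lebesgue measure by the isometry, and the result is factored
    again.\<close>
  have "covariance M (\<lambda>\<omega>. R v \<omega> - R u \<omega>) (\<lambda>\<omega>. R t \<omega> - R s \<omega>) =
      expectation (\<lambda>\<omega>. (R v \<omega> * R t \<omega> - R v \<omega> * R s \<omega>) - (R u \<omega> * R t \<omega> - R u \<omega> * R s \<omega>))"
    unfolding covariance_def using assms by (simp add: mean algebra_simps)
  also have "\<dots> = ((\<integral>x. ?k v x * ?k t x \<partial>lborel) - (\<integral>x. ?k v x * ?k s x \<partial>lborel)) -
      ((\<integral>x. ?k u x * ?k t x \<partial>lborel) - (\<integral>x. ?k u x * ?k s x \<partial>lborel))"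
    using assms by (simp add: si square_integrable_mult wiener_isometry[OF W W])
  also have "\<dots> = (\<integral>x. (?k v x * ?k t x - ?k v x * ?k s x) - (?k u x * ?k t x - ?k u x * ?k s x) \<partial>lborel)"
    using assms by (simp add: si square_integrable_mult)
  also have "\<dots> = (\<integral>x. (?k v x - ?k u x) * (?k t x - ?k s x) \<partial>lborel)"
    by (simp add: algebra_simps)
  finally show ?thesis .
qed

lemma (in standard_brownian_motion) decay_rates_riemann_liouville:
  assumes R: "riemann_liouville_process M B H R" and H: "H > 0" "H \<noteq> 1/2"
    and uvst: "0 \<le> u" "u < v" "v < s" "s < t"
  shows "decay_rates M R u v s t = {..<3/2 - H}"
proof -
  define a where "a = H - 1/2"
  have a: "a > -1" "a \<noteq> 0" using H by (auto simp: a_def)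
  define cov where "cov T = covariance M (\<lambda>\<omega>. R v \<omega> - R u \<omega>) (\<lambda>\<omega>. R (T + t) \<omega> - R (T + s) \<omega>)" for T
  define L where "L = a * (t - s) * ((v powr (a + 1) - u powr (a + 1)) / (a + 1))"
  have "u powr (a + 1) < v powr (a + 1)"
    using a uvst by (intro powr_less_mono2) auto
  \<comment> \<open>Here H \<noteq> 1/2 enters as a \<noteq> 0. At H = 1/2 the process is Brownian
    motion, the covariance over disjoint intervals is zero, and every rate is admissible.\<close>
  then have "L \<noteq> 0" using a uvst by (auto simp: L_def)
  have "(\<lambda>T. cov T) \<in> \<Theta>[at_top](\<lambda>T. T powr (a - 1))"
  proof (rule bigthetaI_tendsto[OF \<open>L \<noteq> 0\<close>])
    have "\<forall>\<^sub>F T in at_top. T powr (1 - a) * (\<integral>x. (rl_kernel a v x - rl_kernel a u x) *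
        (rl_kernel a (T + t) x - rl_kernel a (T + s) x) \<partial>lborel) = cov T / T powr (a - 1)"
      using eventually_gt_at_top[of 0]
    proof eventually_elim
      case (elim T)
      then show ?case
        using covariance_riemann_liouville[OF R, of u v "T + s" "T + t"] uvst
        by (simp add: cov_def a_def[symmetric] powr_diff field_simps)
    qed
    then show "((\<lambda>T. cov T / T powr (a - 1)) \<longlongrightarrow> L) at_top"
      using rl_kernel_covariance_limit[OF a(1) uvst] unfolding L_def[symmetric]
      by (rule Lim_transform_eventually[rotated])
  qed
  \<comment> \<open>The covariance has exact order T^(a-1), which is o(T^(-\<gamma>)) iff a - 1 <
    -\<gamma>. The inequality is strict: at \<gamma> = 1 - a the quotient tends to L, not to
    0.\<close>
  then have "cov \<in> o[at_top](\<lambda>T. T powr (-\<gamma>)) \<longleftrightarrow> \<gamma> < 3/2 - H" for \<gamma>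
    by (subst landau_o.small.in_cong_bigtheta, assumption)
      (simp add: powr_smallo_iff filterlim_ident a_def, linarith)
  then show ?thesis
    unfolding decay_rates_def cov_def by (auto simp: fun_eq_iff)
qed

section \<open>Suprema of rates and the value of the exponent\<close>

lemma SUP_ereal_lessThan: "(SUP \<gamma> \<in> {..<c::real}. ereal \<gamma>) = ereal c"
proof (rule SUP_eqI)
  fix y assume y: "\<And>i. i \<in> {..<c} \<Longrightarrow> ereal i \<le> y"
  show "ereal c \<le> y"
  proof (rule dense_le)
    fix z assume "z < ereal c"
    then obtain \<gamma> where "z < ereal \<gamma>" "ereal \<gamma> < ereal c"
      using ereal_dense2 by blast
    with y[of \<gamma>] show "z \<le> y" by simp
  qed
qed auto

lemma SUP_ereal_greaterThanLessThan:
  assumes "0 < c"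
  shows "(SUP \<gamma> \<in> {0<..<c::real}. ereal \<gamma>) = ereal c"
proof (rule antisym)
  \<comment> \<open>The witness \<open>max \<gamma> (c / 2)\<close> lies strictly between 0 and c
    and dominates \<gamma>, so discarding the rates \<le> 0 leaves the supremum unchanged.\<close>
  have "ereal \<gamma> \<le> (SUP \<gamma> \<in> {0<..<c}. ereal \<gamma>)" if "\<gamma> < c" for \<gamma>
    using assms that by (intro SUP_upper2[of "max \<gamma> (c / 2)"]) auto
  then show "ereal c \<le> (SUP \<gamma> \<in> {0<..<c}. ereal \<gamma>)"
    unfolding SUP_ereal_lessThan[of c, symmetric] by (intro SUP_least) auto
qed (auto intro: SUP_least)

text \<open>For H \<ge> 3/2 no positive rate is admissible, so the supremum over positive rates is
  that of the empty set, minus infinity in \<open>ereal\<close>. The signed exponent gives 3/2 - H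
  there as well.\<close>

theorem proposition2p1:
  fixes M :: "'a measure" and B R :: "real \<Rightarrow> 'a \<Rightarrow> real" and H :: real
  assumes "standard_brownian_motion M B"
    and "H > 0" and "H \<noteq> 1/2"
    and "riemann_liouville_process M B H R"
  shows "(H < 3/2 \<longrightarrow> dependence_exponent M R = ereal (3/2 - H)) \<and>
         signed_dependence_exponent M R = ereal (3/2 - H)"
proof -
  interpret standard_brownian_motion M B by fact
  let ?I = "{(u, v, s, t). 0 \<le> u \<and> u < v \<and> v < s \<and> s < (t::real)}"
  have rates: "decay_rates M R u v s t = {..<3/2 - H}" if "(u, v, s, t) \<in> ?I" for u v s t
    using that by (intro decay_rates_riemann_liouville assms) auto
  \<comment> \<open>An infimum over an empty index set would be infinite, so the infimum of a
    constant requires one admissible quadruple.\<close>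
  have "(0, 1, 2, 3) \<in> ?I" by simp
  then have ne: "?I \<noteq> {}" by blast
  have "signed_dependence_exponent M R = (INF _ \<in> ?I. ereal (3/2 - H))"
    unfolding signed_dependence_exponent_def
  proof (intro INF_cong refl)
    fix x assume "x \<in> ?I"
    then obtain u v s t where x: "x = (u, v, s, t)" "(u, v, s, t) \<in> ?I"
      by (cases x) blast
    then show "(case x of (u, v, s, t) \<Rightarrow> SUP \<gamma> \<in> decay_rates M R u v s t. ereal \<gamma>) =
        ereal (3/2 - H)"
      by (simp only: prod.case rates SUP_ereal_lessThan)
  qed
  moreover have "dependence_exponent M R = (INF _ \<in> ?I. ereal (3/2 - H))" if "H < 3/2"
    unfolding dependence_exponent_def
  proof (intro INF_cong refl)
    fix x assume "x \<in> ?I"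
    then obtain u v s t where x: "x = (u, v, s, t)" "(u, v, s, t) \<in> ?I"
      by (cases x) blast
    have "{\<gamma>. \<gamma> > 0 \<and> \<gamma> \<in> decay_rates M R u v s t} = {0<..<3/2 - H}"
      unfolding rates[OF x(2)] by auto
    moreover have "0 < 3/2 - H" using that by simp
    ultimately show "(case x of (u, v, s, t) \<Rightarrow>
        SUP \<gamma> \<in> {\<gamma>. \<gamma> > 0 \<and> \<gamma> \<in> decay_rates M R u v s t}. ereal \<gamma>) = ereal (3/2 - H)"
      unfolding x(1) by (simp only: prod.case SUP_ereal_greaterThanLessThan)
  qed
  moreover have "(INF _ \<in> ?I. ereal (3/2 - H)) = ereal (3/2 - H)"
    using ne by (rule cINF_const)
  ultimately show ?thesis by simp
qed

end
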